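(* Let $R$ be a ring, and let $M=V_1\oplus\cdots\oplus V_n$ and $N=U_1\oplus\cdots\oplus U_m$ be $R$-modules where all $V_i$ and all $U_j$ are virtually simple $R$-modules. If $M$ and $N$ are $R$-subisomorphic, then $n=m$ and there is a permutation $\sigma$ of $\{1,\ldots,n\}$ such that $U_i\cong V_{\sigma(i)}$ for every $i$.
   Context: All rings are associative with identity and all modules are unitary. An $R$-module $M$ is virtually simple if $M\neq 0$ and $N\cong M$ for every nonzero submodule $N$ of $M$. Two $R$-modules $M$ and $N$ are $R$-subisomorphic if there exist an injective $R$-homomorphism $M\to N$ and an injective $R$-homomorphism $N\to M$. *)

theory Defs
  imports "HOL-Algebra.Module" "HOL-Combinatorics.Permutations"
begin

text \<open>The library locale \<open>module\<close> requires a commutative ring of scalars. The locale below has the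
  same axioms over an arbitrary ring. As there, the ring fields \<open>mult\<close> and \<open>one\<close> of the record \<open>M\<close>
  are unused.\<close>

locale left_module = R?: ring R + M?: abelian_group M for R (structure) and M (structure) +
  assumes smult_closed [simp, intro]:
      "\<lbrakk>a \<in> carrier R; x \<in> carrier M\<rbrakk> \<Longrightarrow> a \<odot>\<^bsub>M\<^esub> x \<in> carrier M"
    and smult_l_distr:
      "\<lbrakk>a \<in> carrier R; b \<in> carrier R; x \<in> carrier M\<rbrakk> \<Longrightarrow>
        (a \<oplus> b) \<odot>\<^bsub>M\<^esub> x = a \<odot>\<^bsub>M\<^esub> x \<oplus>\<^bsub>M\<^esub> b \<odot>\<^bsub>M\<^esub> x"
    and smult_r_distr:
      "\<lbrakk>a \<in> carrier R; x \<in> carrier M; y \<in> carrier M\<rbrakk> \<Longrightarrow>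
        a \<odot>\<^bsub>M\<^esub> (x \<oplus>\<^bsub>M\<^esub> y) = a \<odot>\<^bsub>M\<^esub> x \<oplus>\<^bsub>M\<^esub> a \<odot>\<^bsub>M\<^esub> y"
    and smult_assoc1:
      "\<lbrakk>a \<in> carrier R; b \<in> carrier R; x \<in> carrier M\<rbrakk> \<Longrightarrow>
        (a \<otimes> b) \<odot>\<^bsub>M\<^esub> x = a \<odot>\<^bsub>M\<^esub> (b \<odot>\<^bsub>M\<^esub> x)"
    and smult_one [simp]: "x \<in> carrier M \<Longrightarrow> \<one> \<odot>\<^bsub>M\<^esub> x = x"

definition lmod_hom ::
  "('r, 'c) ring_scheme \<Rightarrow> ('r, 'a, 'd) module_scheme \<Rightarrow> ('r, 'b, 'e) module_scheme \<Rightarrow> ('a \<Rightarrow> 'b) set"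
  where "lmod_hom R M N =
    {f \<in> carrier M \<rightarrow> carrier N.
      (\<forall>x\<in>carrier M. \<forall>y\<in>carrier M. f (x \<oplus>\<^bsub>M\<^esub> y) = f x \<oplus>\<^bsub>N\<^esub> f y) \<and>
      (\<forall>a\<in>carrier R. \<forall>x\<in>carrier M. f (a \<odot>\<^bsub>M\<^esub> x) = a \<odot>\<^bsub>N\<^esub> f x)}"

definition lmod_isomorphic ::
  "('r, 'c) ring_scheme \<Rightarrow> ('r, 'a, 'd) module_scheme \<Rightarrow> ('r, 'b, 'e) module_scheme \<Rightarrow> bool"
  where "lmod_isomorphic R M N \<longleftrightarrow>
    (\<exists>f\<in>lmod_hom R M N. bij_betw f (carrier M) (carrier N))"

definition subisomorphic ::
  "('r, 'c) ring_scheme \<Rightarrow> ('r, 'a, 'd) module_scheme \<Rightarrow> ('r, 'b, 'e) module_scheme \<Rightarrow> bool"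
  where "subisomorphic R M N \<longleftrightarrow>
    (\<exists>f\<in>lmod_hom R M N. inj_on f (carrier M)) \<and>
    (\<exists>g\<in>lmod_hom R N M. inj_on g (carrier N))"

text \<open>A submodule is given by its underlying set \<open>H\<close>; as a module it is \<open>M\<lparr>carrier := H\<rparr>\<close>.\<close>

definition virtually_simple ::
  "('r, 'c) ring_scheme \<Rightarrow> ('r, 'a, 'd) module_scheme \<Rightarrow> bool"
  where "virtually_simple R M \<longleftrightarrow>
    left_module R M \<and> carrier M \<noteq> {\<zero>\<^bsub>M\<^esub>} \<and>
    (\<forall>H. submodule H R M \<and> H \<noteq> {\<zero>\<^bsub>M\<^esub>} \<longrightarrow> lmod_isomorphic R (M\<lparr>carrier := H\<rparr>) M)"

text \<open>External direct sum: finitely supported families. The unused ring fields of the record are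
  left unspecified.\<close>

definition direct_sum ::
  "'i set \<Rightarrow> ('i \<Rightarrow> ('r, 'a, 'd) module_scheme) \<Rightarrow> ('r, 'i \<Rightarrow> 'a) module"
  where "direct_sum I V =
    \<lparr>carrier = {x \<in> \<Pi>\<^sub>E i\<in>I. carrier (V i). finite {i \<in> I. x i \<noteq> \<zero>\<^bsub>V i\<^esub>}},
     monoid.mult = undefined, one = undefined,
     zero = (\<lambda>i\<in>I. \<zero>\<^bsub>V i\<^esub>),
     add = (\<lambda>x y. \<lambda>i\<in>I. x i \<oplus>\<^bsub>V i\<^esub> y i),
     smult = (\<lambda>a x. \<lambda>i\<in>I. a \<odot>\<^bsub>V i\<^esub> x i)\<rparr>"

lemma (in left_module) smult_r_zero [simp]:
  assumes "a \<in> carrier R"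
  shows "a \<odot>\<^bsub>M\<^esub> \<zero>\<^bsub>M\<^esub> = \<zero>\<^bsub>M\<^esub>"
proof -
  have "a \<odot>\<^bsub>M\<^esub> \<zero>\<^bsub>M\<^esub> \<oplus>\<^bsub>M\<^esub> a \<odot>\<^bsub>M\<^esub> \<zero>\<^bsub>M\<^esub> = a \<odot>\<^bsub>M\<^esub> \<zero>\<^bsub>M\<^esub>"
    using smult_r_distr[OF assms M.zero_closed M.zero_closed] by simp
  then show ?thesis
    using assms by (metis M.add.r_cancel_one' M.zero_closed smult_closed)
qed

lemma left_module_direct_sum:
  assumes R: "ring R" and V: "\<And>i. i \<in> I \<Longrightarrow> left_module R (V i)"
  shows "left_module R (direct_sum I V)"
proof -
  have ag: "abelian_group (V i)" if "i \<in> I" for i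
    using V[OF that] by (simp add: left_module_def)
  have z: "\<zero>\<^bsub>V i\<^esub> \<in> carrier (V i)" if "i \<in> I" for i
    using ag[OF that] by (simp add: abelian_group_def abelian_monoid.zero_closed)
  have add: "x \<oplus>\<^bsub>V i\<^esub> y \<in> carrier (V i)" "x \<oplus>\<^bsub>V i\<^esub> y = y \<oplus>\<^bsub>V i\<^esub> x" "\<zero>\<^bsub>V i\<^esub> \<oplus>\<^bsub>V i\<^esub> x = x"
    if "i \<in> I" "x \<in> carrier (V i)" "y \<in> carrier (V i)" for i x y
    using ag[OF that(1)] that(2,3)
    by (auto simp: abelian_group_def abelian_monoid.a_closed abelian_monoid.a_comm
        abelian_monoid.l_zero)
  have assoc: "(x \<oplus>\<^bsub>V i\<^esub> y) \<oplus>\<^bsub>V i\<^esub> w = x \<oplus>\<^bsub>V i\<^esub> (y \<oplus>\<^bsub>V i\<^esub> w)"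
    if "i \<in> I" "x \<in> carrier (V i)" "y \<in> carrier (V i)" "w \<in> carrier (V i)" for i x y w
    using ag[OF that(1)] that(2-) by (simp add: abelian_group_def abelian_monoid.a_assoc)
  have sz: "a \<odot>\<^bsub>V i\<^esub> \<zero>\<^bsub>V i\<^esub> = \<zero>\<^bsub>V i\<^esub>" if "i \<in> I" "a \<in> carrier R" for i a
    using left_module.smult_r_zero[OF V] that by blast
  have supp_add: "finite {i \<in> I. (if i \<in> I then x i \<oplus>\<^bsub>V i\<^esub> y i else undefined) \<noteq> \<zero>\<^bsub>V i\<^esub>}"
    if "finite {i \<in> I. x i \<noteq> \<zero>\<^bsub>V i\<^esub>}" "finite {i \<in> I. y i \<noteq> \<zero>\<^bsub>V i\<^esub>}" for x y
    by (rule finite_subset[OF _ finite_UnI[OF that]]) (use add(3)[OF _ z z] in auto)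
  have supp_smult: "finite {i \<in> I. (if i \<in> I then a \<odot>\<^bsub>V i\<^esub> x i else undefined) \<noteq> \<zero>\<^bsub>V i\<^esub>}"
    if "finite {i \<in> I. x i \<noteq> \<zero>\<^bsub>V i\<^esub>}" "a \<in> carrier R" for x a
    by (rule finite_subset[OF _ that(1)]) (use sz that(2) in auto)
  have "abelian_group (direct_sum I V)"
  proof (rule abelian_groupI, goal_cases)
    case (4 x y)
    then show ?case by (auto simp: direct_sum_def PiE_iff intro!: restrict_ext add(2))
  next
    case (6 x)
    let ?y = "\<lambda>i\<in>I. \<ominus>\<^bsub>V i\<^esub> x i"
    have x: "x i \<in> carrier (V i)" if "i \<in> I" for i
      using 6 that by (auto simp: direct_sum_def)
    have "finite {i \<in> I. ?y i \<noteq> \<zero>\<^bsub>V i\<^esub>}"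
    proof (rule finite_subset)
      show "finite {i \<in> I. x i \<noteq> \<zero>\<^bsub>V i\<^esub>}" using 6 by (simp add: direct_sum_def)
    qed (use abelian_group.minus_equality[OF ag] z add(3)[OF _ z z] in auto)
    moreover have "?y \<in> (\<Pi>\<^sub>E i\<in>I. carrier (V i))"
      using abelian_group.a_inv_closed[OF ag] x by auto
    moreover have "(\<lambda>i\<in>I. ?y i \<oplus>\<^bsub>V i\<^esub> x i) = (\<lambda>i\<in>I. \<zero>\<^bsub>V i\<^esub>)"
      using abelian_group.l_neg[OF ag] x by (auto intro!: restrict_ext)
    ultimately show ?case unfolding direct_sum_def by (intro bexI[of _ ?y]) auto
  qed (auto simp: direct_sum_def PiE_iff z add(1,3) assoc supp_add extensional_def fun_eq_iff)
  moreover have "left_module_axioms R (direct_sum I V)"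
  proof (rule left_module_axioms.intro, goal_cases)
    case (1 a x)
    then show ?case
      by (auto simp: direct_sum_def PiE_iff supp_smult left_module.smult_closed[OF V])
  next
    case (5 x)
    then show ?case
      by (auto simp: direct_sum_def PiE_iff extensional_def fun_eq_iff left_module.smult_one[OF V])
  qed (auto simp: direct_sum_def PiE_iff intro!: restrict_ext left_module.smult_l_distr[OF V]
      left_module.smult_r_distr[OF V] left_module.smult_assoc1[OF V])
  ultimately show ?thesis by (intro left_module.intro R)
qed

end

theory Submission
  imports Defs
begin

text \<open>A virtually simple module is cyclic and isomorphic to its nonzero submodules, so all its
  submodules are cyclic. It is uniform: two nonzero submodules with zero intersection would give
  injective endomorphisms \<open>\<alpha>\<close>, \<open>\<beta>\<close> whose images intersect in zero, and then
  \<open>0 \<subset> \<alpha>V \<subset> \<alpha>V + \<beta>\<alpha>V \<subset> \<dots>\<close> is a strictly increasing chain whose union is cyclic, which is absurd.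

  For an injective map \<open>f\<close> from \<open>\<Oplus>V\<^sub>i\<close> to \<open>\<Oplus>U\<^sub>j\<close> with uniform summands, a Steinitz exchange argument
  removes one \<open>V\<^sub>a\<close> and one \<open>U\<^sub>j\<close> at a time: there is an index \<open>j\<close> such that \<open>V\<^sub>a\<close> embeds in \<open>U\<^sub>j\<close>
  via the \<open>j\<close>-th component of \<open>f\<close>, while \<open>f\<close> followed by the projection killing \<open>U\<^sub>j\<close> is still injective
  on the sum of the remaining \<open>V\<^sub>i\<close>. A nonzero submodule of \<open>U\<^sub>j\<close> is isomorphic to \<open>U\<^sub>j\<close>, so this yields
  an injection of index sets matching isomorphic summands; injections in both directions give \<open>n = m\<close>.\<close>

section \<open>Submodules and homomorphisms\<close>

lemma (in left_module) smult_l_zero [simp]: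
  assumes "x \<in> carrier M"
  shows "\<zero> \<odot>\<^bsub>M\<^esub> x = \<zero>\<^bsub>M\<^esub>"
proof -
  have "\<zero> \<odot>\<^bsub>M\<^esub> x \<oplus>\<^bsub>M\<^esub> \<zero> \<odot>\<^bsub>M\<^esub> x = \<zero> \<odot>\<^bsub>M\<^esub> x"
    using smult_l_distr[OF R.zero_closed R.zero_closed assms] by simp
  then show ?thesis
    using assms by (metis M.add.r_cancel_one' R.zero_closed smult_closed)
qed

text \<open>Expresses negatives through the scalar action: anything closed under scalars, or
  compatible with them, then respects negatives too.\<close>

lemma (in left_module) smult_minus_one:
  assumes "x \<in> carrier M"
  shows "(\<ominus> \<one>) \<odot>\<^bsub>M\<^esub> x = \<ominus>\<^bsub>M\<^esub> x"
proof -
  have "(\<ominus> \<one>) \<odot>\<^bsub>M\<^esub> x \<oplus>\<^bsub>M\<^esub> x = \<zero>\<^bsub>M\<^esub>"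
    using smult_l_distr[of "\<ominus> \<one>" \<one> x] assms by (simp add: R.l_neg)
  then show ?thesis
    using assms M.minus_equality[of "(\<ominus> \<one>) \<odot>\<^bsub>M\<^esub> x" x] by simp
qed

text \<open>A criterion in terms of zero, sums and scalars; negatives come from scaling by minus
  one.\<close>

lemma (in left_module) submodule_iff:
  "submodule H R M \<longleftrightarrow> H \<subseteq> carrier M \<and> \<zero>\<^bsub>M\<^esub> \<in> H \<and>
    (\<forall>x\<in>H. \<forall>y\<in>H. x \<oplus>\<^bsub>M\<^esub> y \<in> H) \<and> (\<forall>a\<in>carrier R. \<forall>x\<in>H. a \<odot>\<^bsub>M\<^esub> x \<in> H)" (is "_ \<longleftrightarrow> ?P")
proof
  assume "submodule H R M"
  then interpret submodule H R M .
  show ?P using subset m_closed one_closed by auto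
next
  assume P: ?P
  have "\<ominus>\<^bsub>M\<^esub> x \<in> H" if "x \<in> H" for x
  proof -
    have "(\<ominus> \<one>) \<odot>\<^bsub>M\<^esub> x \<in> H" using P that by auto
    moreover have "x \<in> carrier M" using P that by auto
    ultimately show ?thesis by (simp only: smult_minus_one)
  qed
  then show "submodule H R M"
    using P by (auto intro!: submodule.intro subgroup.intro simp: submodule_axioms_def a_inv_def)
qed

lemma (in left_module) submodule_carrier: "submodule (carrier M) R M"
  by (simp add: submodule_iff)

lemma (in left_module) submodule_zero_mem:
  "submodule H R M \<Longrightarrow> \<zero>\<^bsub>M\<^esub> \<in> H"
  by (simp add: submodule_iff)

lemma (in left_module) submodule_nonzeroE:
  assumes "submodule H R M" "H \<noteq> {\<zero>\<^bsub>M\<^esub>}"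
  obtains x where "x \<in> H" "x \<noteq> \<zero>\<^bsub>M\<^esub>"
  using assms submodule_zero_mem by blast

lemma (in left_module) submodule_Int:
  "\<lbrakk>submodule H R M; submodule K R M\<rbrakk> \<Longrightarrow> submodule (H \<inter> K) R M"
  by (auto simp: submodule_iff)

lemma (in left_module) submodule_cyclic:
  assumes x: "x \<in> carrier M"
  shows "submodule ((\<lambda>a. a \<odot>\<^bsub>M\<^esub> x) ` carrier R) R M"
  unfolding submodule_iff
proof (intro conjI ballI)
  show "(\<lambda>a. a \<odot>\<^bsub>M\<^esub> x) ` carrier R \<subseteq> carrier M" using x by auto
  show "\<zero>\<^bsub>M\<^esub> \<in> (\<lambda>a. a \<odot>\<^bsub>M\<^esub> x) ` carrier R"
    using smult_l_zero[OF x] by (metis R.zero_closed image_eqI)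
  show "y \<oplus>\<^bsub>M\<^esub> z \<in> (\<lambda>a. a \<odot>\<^bsub>M\<^esub> x) ` carrier R"
    if yz: "y \<in> (\<lambda>a. a \<odot>\<^bsub>M\<^esub> x) ` carrier R" "z \<in> (\<lambda>a. a \<odot>\<^bsub>M\<^esub> x) ` carrier R" for y z
  proof -
    from yz obtain a b where "a \<in> carrier R" "b \<in> carrier R" "y = a \<odot>\<^bsub>M\<^esub> x" "z = b \<odot>\<^bsub>M\<^esub> x" by auto
    then show ?thesis using smult_l_distr[of a b x] x by (intro image_eqI[of _ _ "a \<oplus> b"]) auto
  qed
  show "a \<odot>\<^bsub>M\<^esub> y \<in> (\<lambda>a. a \<odot>\<^bsub>M\<^esub> x) ` carrier R"
    if a: "a \<in> carrier R" and y: "y \<in> (\<lambda>a. a \<odot>\<^bsub>M\<^esub> x) ` carrier R" for a y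
  proof -
    from y obtain b where "b \<in> carrier R" "y = b \<odot>\<^bsub>M\<^esub> x" by auto
    then show ?thesis using smult_assoc1[of a b x] a x by (intro image_eqI[of _ _ "a \<otimes> b"]) auto
  qed
qed

section \<open>Homomorphisms: kernel criterion, images, preimages, isomorphic submodules\<close>

lemma lmod_homI:
  assumes "\<And>x. x \<in> carrier M \<Longrightarrow> f x \<in> carrier N"
    and "\<And>x y. \<lbrakk>x \<in> carrier M; y \<in> carrier M\<rbrakk> \<Longrightarrow> f (x \<oplus>\<^bsub>M\<^esub> y) = f x \<oplus>\<^bsub>N\<^esub> f y"
    and "\<And>a x. \<lbrakk>a \<in> carrier R; x \<in> carrier M\<rbrakk> \<Longrightarrow> f (a \<odot>\<^bsub>M\<^esub> x) = a \<odot>\<^bsub>N\<^esub> f x"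
  shows "f \<in> lmod_hom R M N"
  using assms by (auto simp: lmod_hom_def)

lemma lmod_homD:
  assumes "f \<in> lmod_hom R M N"
  shows lmod_hom_closed: "x \<in> carrier M \<Longrightarrow> f x \<in> carrier N"
    and lmod_hom_add: "\<lbrakk>x \<in> carrier M; y \<in> carrier M\<rbrakk> \<Longrightarrow> f (x \<oplus>\<^bsub>M\<^esub> y) = f x \<oplus>\<^bsub>N\<^esub> f y"
    and lmod_hom_smult: "\<lbrakk>a \<in> carrier R; x \<in> carrier M\<rbrakk> \<Longrightarrow> f (a \<odot>\<^bsub>M\<^esub> x) = a \<odot>\<^bsub>N\<^esub> f x"
  using assms by (auto simp: lmod_hom_def)

lemma lmod_hom_comp:
  assumes "f \<in> lmod_hom R M N" "g \<in> lmod_hom R N P"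
  shows "(\<lambda>x. g (f x)) \<in> lmod_hom R M P"
  by (rule lmod_homI) (simp_all add: lmod_homD[OF assms(1)] lmod_homD[OF assms(2)])

lemma lmod_hom_zero:
  assumes "left_module R M" "left_module R N" "f \<in> lmod_hom R M N"
  shows "f \<zero>\<^bsub>M\<^esub> = \<zero>\<^bsub>N\<^esub>"
proof -
  interpret M: left_module R M by fact
  interpret N: left_module R N by fact
  have "f (\<zero>\<^bsub>R\<^esub> \<odot>\<^bsub>M\<^esub> \<zero>\<^bsub>M\<^esub>) = \<zero>\<^bsub>R\<^esub> \<odot>\<^bsub>N\<^esub> f \<zero>\<^bsub>M\<^esub>" by (rule lmod_hom_smult[OF assms(3)]) auto
  then show ?thesis using lmod_hom_closed[OF assms(3)] by simp
qed

lemma lmod_hom_inj_on_iff: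
  assumes "left_module R M" "left_module R N" and f: "f \<in> lmod_hom R M N"
  shows "inj_on f (carrier M) \<longleftrightarrow> (\<forall>x\<in>carrier M. f x = \<zero>\<^bsub>N\<^esub> \<longrightarrow> x = \<zero>\<^bsub>M\<^esub>)" (is "_ \<longleftrightarrow> ?P")
proof
  interpret M: left_module R M by fact
  interpret N: left_module R N by fact
  show ?P if "inj_on f (carrier M)"
    using that lmod_hom_zero[OF assms] by (metis M.M.zero_closed inj_onD)
  show "inj_on f (carrier M)" if P: ?P
  proof (rule inj_onI)
    fix x y assume xy: "x \<in> carrier M" "y \<in> carrier M" "f x = f y"
    \<comment> \<open>The difference of \<open>x\<close> and \<open>y\<close> is written with the
      scalar minus one, so that additivity and compatibility with scalars put it in the
      kernel.\<close>
    let ?z = "(\<ominus>\<^bsub>R\<^esub> \<one>\<^bsub>R\<^esub>) \<odot>\<^bsub>M\<^esub> y"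
    have "f (x \<oplus>\<^bsub>M\<^esub> ?z) = f x \<oplus>\<^bsub>N\<^esub> (\<ominus>\<^bsub>R\<^esub> \<one>\<^bsub>R\<^esub>) \<odot>\<^bsub>N\<^esub> f y"
      using xy by (simp add: lmod_homD[OF f])
    also have "\<dots> = \<zero>\<^bsub>N\<^esub>"
      using xy lmod_hom_closed[OF f] by (simp add: N.smult_minus_one N.M.r_neg)
    finally have "x \<oplus>\<^bsub>M\<^esub> ?z = \<zero>\<^bsub>M\<^esub>" using P xy by auto
    then have "x \<oplus>\<^bsub>M\<^esub> \<ominus>\<^bsub>M\<^esub> y = \<zero>\<^bsub>M\<^esub>" using xy by (simp add: M.smult_minus_one)
    then have "\<ominus>\<^bsub>M\<^esub> (\<ominus>\<^bsub>M\<^esub> y) = x" using xy by (intro M.M.minus_equality) auto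
    then show "x = y" using xy by simp
  qed
qed

lemma lmod_hom_submodule_image:
  assumes "left_module R M" "left_module R N" and f: "f \<in> lmod_hom R M N"
    and H: "submodule H R M"
  shows "submodule (f ` H) R N"
proof -
  interpret M: left_module R M by fact
  interpret N: left_module R N by fact
  have sub: "x \<in> carrier M" if "x \<in> H" for x using H that by (auto simp: M.submodule_iff)
  show ?thesis
    unfolding N.submodule_iff
  proof (intro conjI ballI)
    show "f ` H \<subseteq> carrier N" using sub lmod_hom_closed[OF f] by auto
    show "\<zero>\<^bsub>N\<^esub> \<in> f ` H"
      using lmod_hom_zero[OF assms(1-3)] H by (auto simp: M.submodule_iff intro: rev_image_eqI)
    show "u \<oplus>\<^bsub>N\<^esub> v \<in> f ` H" if "u \<in> f ` H" "v \<in> f ` H" for u v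
      using that H sub by (auto simp: M.submodule_iff lmod_hom_add[OF f, symmetric])
    show "a \<odot>\<^bsub>N\<^esub> u \<in> f ` H" if "a \<in> carrier R" "u \<in> f ` H" for a u
      using that H sub by (auto simp: M.submodule_iff lmod_hom_smult[OF f, symmetric])
  qed
qed

lemma lmod_hom_submodule_vimage:
  assumes "left_module R M" "left_module R N" and f: "f \<in> lmod_hom R M N"
    and H: "submodule H R N"
  shows "submodule {x \<in> carrier M. f x \<in> H} R M"
proof -
  interpret M: left_module R M by fact
  interpret N: left_module R N by fact
  show ?thesis
    using H unfolding M.submodule_iff N.submodule_iff
    by (simp add: lmod_homD[OF f] lmod_hom_zero[OF assms(1-3)] subset_iff)
qed

lemma lmod_isomorphic_trans:
  assumes "lmod_isomorphic R M N" "lmod_isomorphic R N P"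
  shows "lmod_isomorphic R M P"
proof -
  from assms obtain f g where "f \<in> lmod_hom R M N" "bij_betw f (carrier M) (carrier N)"
    "g \<in> lmod_hom R N P" "bij_betw g (carrier N) (carrier P)"
    by (auto simp: lmod_isomorphic_def)
  then show ?thesis
    unfolding lmod_isomorphic_def
    using lmod_hom_comp bij_betw_trans[unfolded comp_def] by blast
qed

text \<open>The inverse of an isomorphism from \<open>H\<close> to \<open>M\<close>, read as a map
  into \<open>M\<close>. This turns an isomorphic submodule into an injective endomorphism, which
  can be iterated.\<close>

lemma lmod_isomorphic_submodule_embedding:
  assumes "left_module R M" and H: "submodule H R M" and "lmod_isomorphic R (M\<lparr>carrier := H\<rparr>) M"
  shows "\<exists>g\<in>lmod_hom R M M. inj_on g (carrier M) \<and> g ` carrier M = H"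
proof -
  interpret left_module R M by fact
  obtain f where f: "f \<in> lmod_hom R (M\<lparr>carrier := H\<rparr>) M" and bij: "bij_betw f H (carrier M)"
    using assms(3) by (auto simp: lmod_isomorphic_def)
  let ?g = "the_inv_into H f"
  have inj: "inj_on f H" and img: "f ` H = carrier M" using bij by (auto simp: bij_betw_def)
  have g: "bij_betw ?g (carrier M) H" by (rule bij_betw_the_inv_into[OF bij])
  have gf: "?g (f x) = x" if "x \<in> H" for x using the_inv_into_f_f[OF inj that] .
  have "?g \<in> lmod_hom R M M"
  proof (rule lmod_homI)
    show "?g x \<in> carrier M" if "x \<in> carrier M" for x
      using bij_betwE[OF g] that H by (auto simp: submodule_iff)
    show "?g (x \<oplus>\<^bsub>M\<^esub> y) = ?g x \<oplus>\<^bsub>M\<^esub> ?g y" if "x \<in> carrier M" "y \<in> carrier M" for x y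
    proof -
      from that obtain u v where uv: "u \<in> H" "v \<in> H" "x = f u" "y = f v"
        unfolding img[symmetric] by auto
      then have "u \<oplus>\<^bsub>M\<^esub> v \<in> H" using H by (auto simp: submodule_iff)
      moreover have "f (u \<oplus>\<^bsub>M\<^esub> v) = f u \<oplus>\<^bsub>M\<^esub> f v" using lmod_hom_add[OF f, of u v] uv by simp
      ultimately show ?thesis using uv gf by metis
    qed
    show "?g (a \<odot>\<^bsub>M\<^esub> x) = a \<odot>\<^bsub>M\<^esub> ?g x" if "a \<in> carrier R" "x \<in> carrier M" for a x
    proof -
      from that obtain u where u: "u \<in> H" "x = f u" unfolding img[symmetric] by auto
      then have "a \<odot>\<^bsub>M\<^esub> u \<in> H" using H that by (auto simp: submodule_iff)
      moreover have "f (a \<odot>\<^bsub>M\<^esub> u) = a \<odot>\<^bsub>M\<^esub> f u" using lmod_hom_smult[OF f, of a u] that u by simp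
      ultimately show ?thesis using u gf by metis
    qed
  qed
  then show ?thesis using g by (auto simp: bij_betw_def)
qed

section \<open>Virtually simple modules are uniform\<close>

text \<open>Being nonzero is part of the notion, so that even the empty intersection, the whole
  module, has a nonzero element.\<close>

definition uniform_module ::
  "('r, 'c) ring_scheme \<Rightarrow> ('r, 'a, 'd) module_scheme \<Rightarrow> bool"
  where "uniform_module R M \<longleftrightarrow>
    left_module R M \<and> carrier M \<noteq> {\<zero>\<^bsub>M\<^esub>} \<and>
    (\<forall>H K. submodule H R M \<and> submodule K R M \<and> H \<noteq> {\<zero>\<^bsub>M\<^esub>} \<and> K \<noteq> {\<zero>\<^bsub>M\<^esub>} \<longrightarrow>
      H \<inter> K \<noteq> {\<zero>\<^bsub>M\<^esub>})"

text \<open>For a nonzero \<open>x\<close>, the module \<open>M\<close> is isomorphic to the cyclic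
  submodule generated by \<open>x\<close>, hence is generated by the image \<open>e\<close> of
  \<open>x\<close>. An isomorphism from \<open>H\<close> to \<open>M\<close> then carries this back:
  the preimage \<open>y\<close> of \<open>e\<close> generates \<open>H\<close>.\<close>

lemma (in left_module) submodule_cyclic_if_virtually_simple:
  assumes vs: "virtually_simple R M" and H: "submodule H R M" "H \<noteq> {\<zero>\<^bsub>M\<^esub>}"
  shows "\<exists>y\<in>H. H = (\<lambda>a. a \<odot>\<^bsub>M\<^esub> y) ` carrier R"
proof -
  have iso: "\<exists>f\<in>lmod_hom R (M\<lparr>carrier := K\<rparr>) M. bij_betw f K (carrier M)"
    if "submodule K R M" "K \<noteq> {\<zero>\<^bsub>M\<^esub>}" for K
    using vs that by (auto simp: virtually_simple_def lmod_isomorphic_def)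
  obtain x where x: "x \<in> carrier M" "x \<noteq> \<zero>\<^bsub>M\<^esub>"
    using vs M.zero_closed by (fastforce simp: virtually_simple_def)
  let ?K = "(\<lambda>a. a \<odot>\<^bsub>M\<^esub> x) ` carrier R"
  have xK: "x \<in> ?K" by (rule image_eqI[of _ _ "\<one>"]) (use x in auto)
  then have "?K \<noteq> {\<zero>\<^bsub>M\<^esub>}" using x by auto
  then obtain f where f: "f \<in> lmod_hom R (M\<lparr>carrier := ?K\<rparr>) M" "f ` ?K = carrier M"
    using iso[OF submodule_cyclic[OF x(1)]] by (auto simp: bij_betw_def)
  define e where "e = f x"
  have "e \<in> carrier M" using f xK e_def by auto
  have gen: "\<exists>a\<in>carrier R. v = a \<odot>\<^bsub>M\<^esub> e" if v: "v \<in> carrier M" for v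
  proof -
    from v obtain a where a: "a \<in> carrier R" "v = f (a \<odot>\<^bsub>M\<^esub> x)" using f(2) by auto
    then show ?thesis using lmod_hom_smult[OF f(1), of a x] xK by (auto simp: e_def)
  qed
  from iso[OF H] obtain g where g: "g \<in> lmod_hom R (M\<lparr>carrier := H\<rparr>) M"
    "inj_on g H" "g ` H = carrier M" by (auto simp: bij_betw_def)
  obtain y where y: "y \<in> H" "g y = e" using g \<open>e \<in> carrier M\<close> by (metis imageE)
  have Hs: "a \<odot>\<^bsub>M\<^esub> y \<in> H" if "a \<in> carrier R" for a using H(1) y that by (auto simp: submodule_iff)
  have "s \<in> (\<lambda>a. a \<odot>\<^bsub>M\<^esub> y) ` carrier R" if s: "s \<in> H" for s
  proof -
    obtain a where a: "a \<in> carrier R" "g s = a \<odot>\<^bsub>M\<^esub> e" using gen[of "g s"] g(3) s by auto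
    then have "g s = g (a \<odot>\<^bsub>M\<^esub> y)" using lmod_hom_smult[OF g(1), of a y] y by simp
    then have "s = a \<odot>\<^bsub>M\<^esub> y" by (rule inj_onD[OF g(2) _ s Hs[OF a(1)]])
    then show ?thesis using a by auto
  qed
  then show ?thesis using y Hs by (intro bexI[of _ y]) auto
qed

text \<open>Taken with \<open>H\<close> the whole module, this keeps every term of the chain in the
  next lemma a submodule.\<close>

lemma (in left_module) submodule_image_sum:
  assumes a: "\<alpha> \<in> lmod_hom R M M" and b: "\<beta> \<in> lmod_hom R M M"
    and H: "submodule H R M" and K: "submodule K R M"
  shows "submodule {\<alpha> u \<oplus>\<^bsub>M\<^esub> \<beta> v |u v. u \<in> H \<and> v \<in> K} R M" (is "submodule ?S R M")
proof -
  have lm: "left_module R M" by unfold_locales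
  have sub: "x \<in> carrier M" if "x \<in> H \<or> x \<in> K" for x using H K that by (auto simp: submodule_iff)
  note hom = lmod_homD[OF a] lmod_homD[OF b] lmod_hom_zero[OF lm lm a] lmod_hom_zero[OF lm lm b]
  show ?thesis
    unfolding submodule_iff
  proof (intro conjI ballI)
    show "?S \<subseteq> carrier M" using sub by (auto simp: hom)
    have "\<zero>\<^bsub>M\<^esub> = \<alpha> \<zero>\<^bsub>M\<^esub> \<oplus>\<^bsub>M\<^esub> \<beta> \<zero>\<^bsub>M\<^esub>" by (simp add: hom)
    then show "\<zero>\<^bsub>M\<^esub> \<in> ?S" using H K by (auto simp: submodule_iff)
    show "x \<oplus>\<^bsub>M\<^esub> y \<in> ?S" if xy: "x \<in> ?S" "y \<in> ?S" for x y
    proof -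
      from xy obtain u v u' v' where uv: "u \<in> H" "v \<in> K" "u' \<in> H" "v' \<in> K"
        "x = \<alpha> u \<oplus>\<^bsub>M\<^esub> \<beta> v" "y = \<alpha> u' \<oplus>\<^bsub>M\<^esub> \<beta> v'" by auto
      then have "x \<oplus>\<^bsub>M\<^esub> y = \<alpha> (u \<oplus>\<^bsub>M\<^esub> u') \<oplus>\<^bsub>M\<^esub> \<beta> (v \<oplus>\<^bsub>M\<^esub> v')"
        using sub by (simp add: hom M.a_ac)
      moreover have "u \<oplus>\<^bsub>M\<^esub> u' \<in> H" "v \<oplus>\<^bsub>M\<^esub> v' \<in> K" using uv H K by (auto simp: submodule_iff)
      ultimately show ?thesis by blast
    qed
    show "c \<odot>\<^bsub>M\<^esub> x \<in> ?S" if c: "c \<in> carrier R" and x: "x \<in> ?S" for c x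
    proof -
      from x obtain u v where uv: "u \<in> H" "v \<in> K" "x = \<alpha> u \<oplus>\<^bsub>M\<^esub> \<beta> v" by auto
      then have "c \<odot>\<^bsub>M\<^esub> x = \<alpha> (c \<odot>\<^bsub>M\<^esub> u) \<oplus>\<^bsub>M\<^esub> \<beta> (c \<odot>\<^bsub>M\<^esub> v)"
        using sub c by (simp add: hom smult_r_distr)
      moreover have "c \<odot>\<^bsub>M\<^esub> u \<in> H" "c \<odot>\<^bsub>M\<^esub> v \<in> K" using uv c H K by (auto simp: submodule_iff)
      ultimately show ?thesis by blast
    qed
  qed
qed

text \<open>If the images met only in zero, iterating T \<mapsto> \<alpha>M + \<beta>T from zero
  would give a strictly increasing chain. A generator of its union lies in some term, and that term
  would already be the whole union.\<close>

lemma (in left_module) image_Int_nonzero_if_submodules_cyclic: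
  assumes a: "\<alpha> \<in> lmod_hom R M M" "inj_on \<alpha> (carrier M)"
    and b: "\<beta> \<in> lmod_hom R M M" "inj_on \<beta> (carrier M)"
    and nz: "carrier M \<noteq> {\<zero>\<^bsub>M\<^esub>}"
    and cyc: "\<And>H. \<lbrakk>submodule H R M; H \<noteq> {\<zero>\<^bsub>M\<^esub>}\<rbrakk> \<Longrightarrow> \<exists>y\<in>H. H = (\<lambda>a. a \<odot>\<^bsub>M\<^esub> y) ` carrier R"
  shows "\<alpha> ` carrier M \<inter> \<beta> ` carrier M \<noteq> {\<zero>\<^bsub>M\<^esub>}"
proof
  assume int: "\<alpha> ` carrier M \<inter> \<beta> ` carrier M = {\<zero>\<^bsub>M\<^esub>}"
  have lm: "left_module R M" by unfold_locales
  note hom = lmod_homD[OF a(1)] lmod_homD[OF b(1)]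
    lmod_hom_zero[OF lm lm a(1)] lmod_hom_zero[OF lm lm b(1)]
  \<comment> \<open>\<open>S k\<close> is the sum of the submodules \<beta>^i \<alpha>M over i < k,
    built from the outside: each step applies \<beta> to the previous sum and adds
    \<alpha>M.\<close>
  define F where "F T = {\<alpha> u \<oplus>\<^bsub>M\<^esub> \<beta> t |u t. u \<in> carrier M \<and> t \<in> T}" for T
  define S where "S k = (F ^^ k) {\<zero>\<^bsub>M\<^esub>}" for k
  have S_Suc: "S (Suc k) = F (S k)" and S_0: "S 0 = {\<zero>\<^bsub>M\<^esub>}" for k by (simp_all add: S_def)
  have sm: "submodule (S k) R M" for k
  proof (induction k)
    case 0
    then show ?case by (simp add: S_0 submodule_iff)
  next
    case (Suc k)
    then show ?case unfolding S_Suc F_def by (intro submodule_image_sum a b submodule_carrier)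
  qed
  have Sc: "x \<in> carrier M" if "x \<in> S k" for x k using sm[of k] that by (auto simp: submodule_iff)
  have S0: "\<zero>\<^bsub>M\<^esub> \<in> S k" for k using sm[of k] by (auto simp: submodule_iff)
  have mono: "S k \<subseteq> S (Suc k)" for k
  proof (induction k)
    case 0
    then show ?case using S0 by (simp add: S_0)
  next
    case (Suc k)
    then show ?case unfolding S_Suc F_def by blast
  qed
  \<comment> \<open>The first step is proper because \<alpha> is injective and \<open>M\<close> is
    nonzero. Later equalities cancel downwards: if \<open>S (k+2)\<close> lies in
    \<open>S (k+1)\<close>, then for t in \<open>S (k+1)\<close> one has \<beta>t = \<alpha>u +
    \<beta>t' with t' in \<open>S k\<close>. So \<beta>(t - t') = \<alpha>u lies in both images and
    is zero, whence t = t' lies in \<open>S k\<close>, against the induction hypothesis.\<close>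
  have strict: "\<not> S (Suc k) \<subseteq> S k" for k
  proof (induction k)
    case 0
    obtain x where x: "x \<in> carrier M" "x \<noteq> \<zero>\<^bsub>M\<^esub>" using nz M.zero_closed by fastforce
    have "\<alpha> x \<oplus>\<^bsub>M\<^esub> \<beta> \<zero>\<^bsub>M\<^esub> \<in> S (Suc 0)" unfolding S_Suc F_def S_0 using x by blast
    then have "\<alpha> x \<in> S (Suc 0)" using x by (simp add: hom)
    moreover have "\<alpha> x \<noteq> \<zero>\<^bsub>M\<^esub>" using a lmod_hom_inj_on_iff[OF lm lm a(1)] x by auto
    ultimately show ?case by (auto simp: S_0)
  next
    case (Suc k)
    show ?case
    proof
      assume sub: "S (Suc (Suc k)) \<subseteq> S (Suc k)"
      have "t \<in> S k" if t: "t \<in> S (Suc k)" for t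
      proof -
        note tc = Sc[OF t]
        have "\<alpha> \<zero>\<^bsub>M\<^esub> \<oplus>\<^bsub>M\<^esub> \<beta> t \<in> S (Suc (Suc k))"
          unfolding S_Suc[of "Suc k"] F_def using t by blast
        then have "\<beta> t \<in> F (S k)" using sub tc S_Suc[of k] by (auto simp: hom)
        then obtain u t' where u: "u \<in> carrier M" "t' \<in> S k" "\<beta> t = \<alpha> u \<oplus>\<^bsub>M\<^esub> \<beta> t'"
          by (auto simp: F_def)
        note t'c = Sc[OF u(2)]
        let ?d = "(\<ominus> \<one>) \<odot>\<^bsub>M\<^esub> t'"
        have d: "?d \<in> carrier M" using t'c by simp
        have "\<beta> ?d = \<ominus>\<^bsub>M\<^esub> \<beta> t'"
          using lmod_hom_smult[OF b(1), of "\<ominus> \<one>" t'] t'c smult_minus_one[of "\<beta> t'"]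
          by (simp add: hom)
        then have "\<beta> (t \<oplus>\<^bsub>M\<^esub> ?d) = (\<alpha> u \<oplus>\<^bsub>M\<^esub> \<beta> t') \<oplus>\<^bsub>M\<^esub> \<ominus>\<^bsub>M\<^esub> \<beta> t'"
          using lmod_hom_add[OF b(1) tc d] u(3) by simp
        also have "\<dots> = \<alpha> u" using u(1) t'c by (simp add: hom M.a_assoc M.r_neg)
        finally have eq: "\<beta> (t \<oplus>\<^bsub>M\<^esub> ?d) = \<alpha> u" .
        have "\<alpha> u \<in> \<alpha> ` carrier M \<inter> \<beta> ` carrier M"
          using eq u(1) tc d by (metis IntI M.a_closed imageI)
        then have "\<alpha> u = \<zero>\<^bsub>M\<^esub>" using int by auto
        then have "\<beta> t = \<beta> t'" using u t'c by (simp add: hom)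
        then show ?thesis using u b(2) tc t'c by (auto dest: inj_onD)
      qed
      then show False using Suc.IH by auto
    qed
  qed
  have le: "S k \<subseteq> S l" if "k \<le> l" for k l using lift_Suc_mono_le[of S] mono that by blast
  have "submodule (\<Union>k. S k) R M"
    unfolding submodule_iff
  proof (intro conjI ballI)
    show "(\<Union>k. S k) \<subseteq> carrier M" using Sc by auto
    show "\<zero>\<^bsub>M\<^esub> \<in> (\<Union>k. S k)" using S0 by auto
    show "c \<odot>\<^bsub>M\<^esub> x \<in> (\<Union>k. S k)" if c: "c \<in> carrier R" and x: "x \<in> (\<Union>k. S k)" for c x
    proof -
      from x obtain k where "x \<in> S k" by auto
      then have "c \<odot>\<^bsub>M\<^esub> x \<in> S k" using c sm[of k] by (auto simp: submodule_iff)
      then show ?thesis by auto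
    qed
    \<comment> \<open>The terms form a chain, so two elements of the union lie in a common
      term.\<close>
    show "x \<oplus>\<^bsub>M\<^esub> y \<in> (\<Union>k. S k)" if "x \<in> (\<Union>k. S k)" "y \<in> (\<Union>k. S k)" for x y
    proof -
      from that obtain k l where "x \<in> S k" "y \<in> S l" by auto
      then have "x \<in> S (max k l)" "y \<in> S (max k l)"
        using le[of k "max k l"] le[of l "max k l"] by auto
      then have "x \<oplus>\<^bsub>M\<^esub> y \<in> S (max k l)" using sm[of "max k l"] by (auto simp: submodule_iff)
      then show ?thesis by auto
    qed
  qed
  then have "\<exists>y\<in>\<Union>k. S k. (\<Union>k. S k) = (\<lambda>a. a \<odot>\<^bsub>M\<^esub> y) ` carrier R"
  proof (rule cyc)
    show "(\<Union>k. S k) \<noteq> {\<zero>\<^bsub>M\<^esub>}" using strict[of 0] S_0 by blast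
  qed
  then obtain y where y: "y \<in> (\<Union>k. S k)" "(\<Union>k. S k) = (\<lambda>a. a \<odot>\<^bsub>M\<^esub> y) ` carrier R"
    by blast
  then obtain k where "y \<in> S k" by auto
  \<comment> \<open>\<open>S k\<close> contains the generator \<open>y\<close> of the union, hence
    all its multiples.\<close>
  then have "(\<Union>k. S k) \<subseteq> S k" unfolding y(2) using sm[of k] by (auto simp: submodule_iff)
  then show False using strict[of k] by auto
qed

text \<open>Two nonzero submodules are the images of injective endomorphisms, and all nonzero
  submodules are cyclic, so the chain argument above applies.\<close>

lemma uniform_module_if_virtually_simple:
  assumes vs: "virtually_simple R M"
  shows "uniform_module R M"
  unfolding uniform_module_def
proof (intro conjI allI impI)
  show lm: "left_module R M" and nz: "carrier M \<noteq> {\<zero>\<^bsub>M\<^esub>}"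
    using vs by (auto simp: virtually_simple_def)
  interpret left_module R M by fact
  have emb: "\<exists>g\<in>lmod_hom R M M. inj_on g (carrier M) \<and> g ` carrier M = H"
    if "submodule H R M" "H \<noteq> {\<zero>\<^bsub>M\<^esub>}" for H
    using lmod_isomorphic_submodule_embedding[OF lm that(1)] vs that by (auto simp: virtually_simple_def)
  fix H K assume *: "submodule H R M \<and> submodule K R M \<and> H \<noteq> {\<zero>\<^bsub>M\<^esub>} \<and> K \<noteq> {\<zero>\<^bsub>M\<^esub>}"
  from * emb[of H] obtain \<alpha> where \<alpha>: "\<alpha> \<in> lmod_hom R M M" "inj_on \<alpha> (carrier M)"
    and H: "\<alpha> ` carrier M = H" by auto
  from * emb[of K] obtain \<beta> where \<beta>: "\<beta> \<in> lmod_hom R M M" "inj_on \<beta> (carrier M)"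
    and K: "\<beta> ` carrier M = K" by auto
  show "H \<inter> K \<noteq> {\<zero>\<^bsub>M\<^esub>}"
    unfolding H[symmetric] K[symmetric]
    by (rule image_Int_nonzero_if_submodules_cyclic[OF \<alpha> \<beta> nz submodule_cyclic_if_virtually_simple[OF vs]])
qed

section \<open>Exchange\<close>

lemma uniform_module_INT_nonzero:
  assumes u: "uniform_module R M" and "finite B"
    and "\<And>j. j \<in> B \<Longrightarrow> submodule (K j) R M \<and> K j \<noteq> {\<zero>\<^bsub>M\<^esub>}"
  shows "\<exists>x\<in>carrier M. x \<noteq> \<zero>\<^bsub>M\<^esub> \<and> (\<forall>j\<in>B. x \<in> K j)"
proof -
  interpret left_module R M using u by (simp add: uniform_module_def)
  \<comment> \<open>Intersecting with \<open>carrier M\<close> makes the empty family give the whole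
    module, which starts the induction.\<close>
  have "submodule (carrier M \<inter> (\<Inter>j\<in>B. K j)) R M \<and> carrier M \<inter> (\<Inter>j\<in>B. K j) \<noteq> {\<zero>\<^bsub>M\<^esub>}"
    using assms(2,3)
  proof (induction B)
    case empty
    then show ?case using u submodule_carrier by (simp add: uniform_module_def)
  next
    case (insert j B)
    have eq: "carrier M \<inter> (\<Inter>i\<in>insert j B. K i) = K j \<inter> (carrier M \<inter> (\<Inter>i\<in>B. K i))" by auto
    show ?case unfolding eq using insert submodule_Int u by (simp add: uniform_module_def)
  qed
  then obtain x where "x \<in> carrier M \<inter> (\<Inter>j\<in>B. K j)" "x \<noteq> \<zero>\<^bsub>M\<^esub>"
    using submodule_nonzeroE by metis
  then show ?thesis by auto
qed

text \<open>Here \<open>\<phi>\<close> is the family of components of a map \<open>D \<rightarrow> \<Oplus>U\<^sub>j\<close>, and the hypothesis \<open>indep\<close> says that the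
  composite \<open>X \<rightarrow> \<Oplus>U\<^sub>j\<close> is injective with image meeting the image of \<open>S\<close> trivially.\<close>

lemma uniform_exchange:
  fixes U :: "'j \<Rightarrow> ('r, 'b, 'e) module_scheme"
  assumes D: "left_module R D" and S: "submodule S R D"
    and X: "uniform_module R X" and \<iota>: "\<iota> \<in> lmod_hom R X D"
    and B: "finite B" and U: "\<And>j. j \<in> B \<Longrightarrow> uniform_module R (U j)"
    and \<phi>: "\<And>j. j \<in> B \<Longrightarrow> \<phi> j \<in> lmod_hom R D (U j)"
    and indep: "\<And>v s. \<lbrakk>v \<in> carrier X; s \<in> S; \<forall>j\<in>B. \<phi> j s = \<phi> j (\<iota> v)\<rbrakk> \<Longrightarrow> v = \<zero>\<^bsub>X\<^esub>"
  shows "\<exists>j\<in>B. (\<forall>s\<in>S. (\<forall>k\<in>B - {j}. \<phi> k s = \<zero>\<^bsub>U k\<^esub>) \<longrightarrow> \<phi> j s = \<zero>\<^bsub>U j\<^esub>) \<and>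
    inj_on (\<lambda>v. \<phi> j (\<iota> v)) (carrier X)"
proof (rule ccontr)
  assume contr: "\<not> ?thesis"
  have Xl: "left_module R X" and Ul: "\<And>j. j \<in> B \<Longrightarrow> left_module R (U j)"
    using X U by (auto simp: uniform_module_def)
  interpret D: left_module R D by fact
  interpret X: left_module R X by fact
  note hom = lmod_homD[OF \<phi>] lmod_hom_zero[OF D Ul \<phi>]
  have Sc: "s \<in> carrier D" if "s \<in> S" for s using S that by (auto simp: D.submodule_iff)
  have Uz: "\<zero>\<^bsub>U j\<^esub> \<oplus>\<^bsub>U j\<^esub> x = x" "x \<oplus>\<^bsub>U j\<^esub> \<zero>\<^bsub>U j\<^esub> = x"
    if "j \<in> B" "x \<in> carrier (U j)" for j x
  proof -
    interpret U: left_module R "U j" using Ul[OF that(1)] .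
    show "\<zero>\<^bsub>U j\<^esub> \<oplus>\<^bsub>U j\<^esub> x = x" "x \<oplus>\<^bsub>U j\<^esub> \<zero>\<^bsub>U j\<^esub> = x" using that by auto
  qed
  have Uzc: "\<zero>\<^bsub>U j\<^esub> \<in> carrier (U j)" if "j \<in> B" for j
    using lmod_hom_closed[OF \<phi>[OF that] D.M.zero_closed] lmod_hom_zero[OF D Ul[OF that] \<phi>[OF that]] that
    by simp
  \<comment> \<open>\<open>T j\<close> consists of the elements of \<open>S\<close> whose only
    possibly nonzero component in \<open>B\<close> is the \<open>j\<close>-th. So \<open>E j\<close>
    is the part of the image of \<open>S\<close> inside the single summand \<open>U j\<close>, and
    \<open>K j\<close> is its preimage in \<open>X\<close>. The first half of the claim for
    \<open>j\<close> says that \<open>E j\<close> is zero.\<close>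
  define T where "T j = {s \<in> S. \<forall>k\<in>B - {j}. \<phi> k s = \<zero>\<^bsub>U k\<^esub>}" for j
  define E where "E j = \<phi> j ` T j" for j
  define K where "K j = {v \<in> carrier X. \<phi> j (\<iota> v) \<in> E j}" for j
  have T: "submodule (T j) R D" if "j \<in> B" for j
  proof -
    have "\<And>k a. k \<in> B \<Longrightarrow> a \<in> carrier R \<Longrightarrow> a \<odot>\<^bsub>U k\<^esub> \<zero>\<^bsub>U k\<^esub> = \<zero>\<^bsub>U k\<^esub>"
      by (rule left_module.smult_r_zero[OF Ul])
    then show ?thesis
      using S by (auto simp: T_def D.submodule_iff hom subset_iff Uz Uzc)
  qed
  have E: "submodule (E j) R (U j)" if "j \<in> B" for j
    unfolding E_def by (rule lmod_hom_submodule_image[OF D Ul[OF that] \<phi>[OF that] T[OF that]])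
  have \<phi>\<iota>: "(\<lambda>v. \<phi> j (\<iota> v)) \<in> lmod_hom R X (U j)" if "j \<in> B" for j
    using lmod_hom_comp[OF \<iota> \<phi>[OF that]] .
  have K: "submodule (K j) R X" if "j \<in> B" for j
    unfolding K_def by (rule lmod_hom_submodule_vimage[OF Xl Ul[OF that] \<phi>\<iota>[OF that] E[OF that]])
  \<comment> \<open>By \<open>contr\<close>, for each \<open>j\<close> either X \<rightarrow>
    \<open>U j\<close> is not injective, and its kernel lies in \<open>K j\<close>, or
    \<open>E j\<close> is nonzero. In the second case uniformity of \<open>U j\<close> makes the
    image of \<open>X\<close> meet \<open>E j\<close> outside zero, and a preimage of such a common
    element is nonzero in \<open>K j\<close>.\<close>
  have Knz: "K j \<noteq> {\<zero>\<^bsub>X\<^esub>}" if j: "j \<in> B" for j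
  proof (cases "inj_on (\<lambda>v. \<phi> j (\<iota> v)) (carrier X)")
    case False
    then obtain v where v: "v \<in> carrier X" "\<phi> j (\<iota> v) = \<zero>\<^bsub>U j\<^esub>" "v \<noteq> \<zero>\<^bsub>X\<^esub>"
      using lmod_hom_inj_on_iff[OF Xl Ul[OF j] \<phi>\<iota>[OF j]] by auto
    moreover have "\<zero>\<^bsub>U j\<^esub> \<in> E j"
      by (rule left_module.submodule_zero_mem[OF Ul[OF j] E[OF j]])
    ultimately have "v \<in> K j" by (simp add: K_def)
    then show ?thesis using v by auto
  next
    case True
    let ?I = "(\<lambda>v. \<phi> j (\<iota> v)) ` carrier X"
    have inj: "\<And>v. v \<in> carrier X \<Longrightarrow> \<phi> j (\<iota> v) = \<zero>\<^bsub>U j\<^esub> \<Longrightarrow> v = \<zero>\<^bsub>X\<^esub>"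
      using True lmod_hom_inj_on_iff[OF Xl Ul[OF j] \<phi>\<iota>[OF j]] by auto
    obtain s where "s \<in> T j" "\<phi> j s \<noteq> \<zero>\<^bsub>U j\<^esub>" using contr j True by (auto simp: T_def)
    then have Enz: "E j \<noteq> {\<zero>\<^bsub>U j\<^esub>}" by (auto simp: E_def)
    obtain v where "v \<in> carrier X" "v \<noteq> \<zero>\<^bsub>X\<^esub>"
      using X X.M.zero_closed by (fastforce simp: uniform_module_def)
    then have "?I \<noteq> {\<zero>\<^bsub>U j\<^esub>}" using inj by auto
    moreover have I: "submodule ?I R (U j)"
      by (rule lmod_hom_submodule_image[OF Xl Ul[OF j] \<phi>\<iota>[OF j] X.submodule_carrier])
    ultimately have "?I \<inter> E j \<noteq> {\<zero>\<^bsub>U j\<^esub>}"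
      using E[OF j] Enz U[OF j] by (auto simp: uniform_module_def)
    moreover have "\<zero>\<^bsub>U j\<^esub> \<in> ?I \<inter> E j"
      using left_module.submodule_zero_mem[OF Ul[OF j]] E[OF j] I by simp
    ultimately obtain w where w: "w \<in> carrier X" "\<phi> j (\<iota> w) \<in> E j" "\<phi> j (\<iota> w) \<noteq> \<zero>\<^bsub>U j\<^esub>" by auto
    have "\<phi> j (\<iota> \<zero>\<^bsub>X\<^esub>) = \<zero>\<^bsub>U j\<^esub>" using lmod_hom_zero[OF Xl Ul[OF j] \<phi>\<iota>[OF j]] .
    then have "w \<noteq> \<zero>\<^bsub>X\<^esub>" using w(3) by metis
    moreover have "w \<in> K j" using w by (simp add: K_def)
    ultimately show ?thesis by auto
  qed
  \<comment> \<open>Uniformity of \<open>X\<close> gives one nonzero \<open>v\<close> in all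
    \<open>K j\<close> at once: every component of its image is realised by an element of
    \<open>S\<close> concentrated at that component.\<close>
  obtain v where v: "v \<in> carrier X" "v \<noteq> \<zero>\<^bsub>X\<^esub>" "\<And>j. j \<in> B \<Longrightarrow> v \<in> K j"
    using uniform_module_INT_nonzero[OF X B, of K] K Knz by auto
  note \<iota>v = lmod_hom_closed[OF \<iota> v(1)]
  \<comment> \<open>Adding up these concentrated elements over \<open>C\<close> copies the
    components of the image of \<open>v\<close> on \<open>C\<close>. With \<open>C = B\<close> the
    sum agrees with that image on all of \<open>B\<close>, which \<open>indep\<close> forbids for
    nonzero \<open>v\<close>.\<close>
  have "\<exists>s\<in>S. \<forall>j\<in>B. \<phi> j s = (if j \<in> C then \<phi> j (\<iota> v) else \<zero>\<^bsub>U j\<^esub>)" if "finite C" "C \<subseteq> B" for C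
    using that
  proof (induction C)
    case empty
    then show ?case using S by (auto simp: D.submodule_iff hom intro!: bexI[of _ "\<zero>\<^bsub>D\<^esub>"])
  next
    case (insert c C)
    then obtain s where s: "s \<in> S" "\<forall>j\<in>B. \<phi> j s = (if j \<in> C then \<phi> j (\<iota> v) else \<zero>\<^bsub>U j\<^esub>)" by auto
    have c: "c \<in> B" using insert by simp
    obtain t where t: "t \<in> S" "\<forall>k\<in>B - {c}. \<phi> k t = \<zero>\<^bsub>U k\<^esub>" "\<phi> c t = \<phi> c (\<iota> v)"
      using v(3)[OF c] by (auto simp: K_def E_def T_def)
    have "s \<oplus>\<^bsub>D\<^esub> t \<in> S" using s t S by (auto simp: D.submodule_iff)
    moreover have "\<forall>j\<in>B. \<phi> j (s \<oplus>\<^bsub>D\<^esub> t) = (if j \<in> insert c C then \<phi> j (\<iota> v) else \<zero>\<^bsub>U j\<^esub>)"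
    proof
      fix j assume j: "j \<in> B"
      have "\<phi> j (s \<oplus>\<^bsub>D\<^esub> t) = \<phi> j s \<oplus>\<^bsub>U j\<^esub> \<phi> j t" using j s(1) t(1) Sc by (simp add: hom)
      moreover have "\<phi> j t = (if j = c then \<phi> j (\<iota> v) else \<zero>\<^bsub>U j\<^esub>)" using t j by simp
      moreover have "\<phi> j (\<iota> v) \<in> carrier (U j)" using j \<iota>v by (simp add: hom)
      ultimately show "\<phi> j (s \<oplus>\<^bsub>D\<^esub> t) = (if j \<in> insert c C then \<phi> j (\<iota> v) else \<zero>\<^bsub>U j\<^esub>)"
        using s(2) j insert.hyps by (auto simp: Uz Uzc)
    qed
    ultimately show ?case by blast
  qed
  from this[OF B subset_refl] obtain s where "s \<in> S" "\<forall>j\<in>B. \<phi> j s = \<phi> j (\<iota> v)" by auto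
  then show False using indep[OF v(1)] v(2) by simp
qed

section \<open>Direct sums of virtually simple modules\<close>

lemma direct_sum_proj_hom:
  assumes "j \<in> I"
  shows "(\<lambda>x. x j) \<in> lmod_hom R (direct_sum I V) (V j)"
  by (rule lmod_homI) (use assms in \<open>simp_all add: direct_sum_def PiE_iff\<close>)

lemma direct_sum_incl_hom:
  assumes V: "\<And>i. i \<in> I \<Longrightarrow> left_module R (V i)" and i: "i \<in> I"
  shows "(\<lambda>v. \<lambda>k\<in>I. if k = i then v else \<zero>\<^bsub>V k\<^esub>) \<in> lmod_hom R (V i) (direct_sum I V)"
proof -
  have z: "\<zero>\<^bsub>V k\<^esub> \<in> carrier (V k)" "\<zero>\<^bsub>V k\<^esub> \<oplus>\<^bsub>V k\<^esub> \<zero>\<^bsub>V k\<^esub> = \<zero>\<^bsub>V k\<^esub>" 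
    "a \<in> carrier R \<Longrightarrow> a \<odot>\<^bsub>V k\<^esub> \<zero>\<^bsub>V k\<^esub> = \<zero>\<^bsub>V k\<^esub>" if "k \<in> I" for k a
  proof -
    interpret left_module R "V k" using V[OF that] .
    show "\<zero>\<^bsub>V k\<^esub> \<in> carrier (V k)" "\<zero>\<^bsub>V k\<^esub> \<oplus>\<^bsub>V k\<^esub> \<zero>\<^bsub>V k\<^esub> = \<zero>\<^bsub>V k\<^esub>" 
      "a \<in> carrier R \<Longrightarrow> a \<odot>\<^bsub>V k\<^esub> \<zero>\<^bsub>V k\<^esub> = \<zero>\<^bsub>V k\<^esub>" by auto
  qed
  have fin: "finite {k \<in> I. (if k \<in> I then if k = i then v else \<zero>\<^bsub>V k\<^esub> else undefined) \<noteq> \<zero>\<^bsub>V k\<^esub>}" for v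
    by (rule finite_subset[of _ "{i}"]) (auto split: if_splits)
  show ?thesis
    by (rule lmod_homI) (use i in \<open>auto simp: direct_sum_def z fin fun_eq_iff\<close>)
qed

text \<open>The sets \<open>A\<close> and \<open>B\<close> record the summands not yet exchanged; the premise \<open>indep\<close> is injectivity on
  the families supported in \<open>A\<close> of the components of \<open>f\<close> with index in \<open>B\<close>.\<close>

lemma direct_sum_matching:
  assumes R: "ring R"
    and V: "\<And>i. i \<in> I \<Longrightarrow> virtually_simple R (V i)"
    and U: "\<And>j. j \<in> J \<Longrightarrow> virtually_simple R (U j)"
    and f: "f \<in> lmod_hom R (direct_sum I V) (direct_sum J U)"
    and "finite A" "A \<subseteq> I" "finite B" "B \<subseteq> J"
    and indep: "\<And>x. \<lbrakk>x \<in> carrier (direct_sum I V); \<forall>i\<in>I - A. x i = \<zero>\<^bsub>V i\<^esub>; \<forall>j\<in>B. f x j = \<zero>\<^bsub>U j\<^esub>\<rbrakk>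
      \<Longrightarrow> x = \<zero>\<^bsub>direct_sum I V\<^esub>"
  shows "\<exists>\<tau>. inj_on \<tau> A \<and> \<tau> ` A \<subseteq> B \<and> (\<forall>i\<in>A. lmod_isomorphic R (V i) (U (\<tau> i)))"
  using assms(5-)
proof (induction A arbitrary: B)
  case empty
  then show ?case by simp
next
  case (insert a A)
  let ?D = "direct_sum I V"
  let ?\<iota> = "\<lambda>v. \<lambda>k\<in>I. if k = a then v else \<zero>\<^bsub>V k\<^esub>"
  \<comment> \<open>\<open>S\<close> is the sum of the summands indexed by \<open>A\<close>, to be
    kept when \<open>V a\<close> is split off.\<close>
  define S where "S = {x \<in> carrier ?D. \<forall>i\<in>I - A. x i = \<zero>\<^bsub>V i\<^esub>}"
  have a: "a \<in> I" "a \<notin> A" using insert by auto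
  have Vl: "left_module R (V i)" if "i \<in> I" for i using V[OF that] by (simp add: virtually_simple_def)
  have Ul: "left_module R (U j)" if "j \<in> J" for j using U[OF that] by (simp add: virtually_simple_def)
  have D: "left_module R ?D" by (rule left_module_direct_sum[OF R Vl])
  interpret D: left_module R ?D by fact
  interpret Va: left_module R "V a" by (rule Vl[OF a(1)])
  have \<iota>: "?\<iota> \<in> lmod_hom R (V a) ?D" by (rule direct_sum_incl_hom[OF Vl a(1)])
  have \<phi>: "(\<lambda>x. f x j) \<in> lmod_hom R ?D (U j)" if "j \<in> B" for j
    using lmod_hom_comp[OF f direct_sum_proj_hom] that insert.prems by blast
  have S: "submodule S R ?D"
  proof -
    have "\<zero>\<^bsub>V k\<^esub> \<oplus>\<^bsub>V k\<^esub> \<zero>\<^bsub>V k\<^esub> = \<zero>\<^bsub>V k\<^esub>" "c \<in> carrier R \<Longrightarrow> c \<odot>\<^bsub>V k\<^esub> \<zero>\<^bsub>V k\<^esub> = \<zero>\<^bsub>V k\<^esub>"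
      if "k \<in> I" for k c
    proof -
      interpret left_module R "V k" using Vl[OF that] .
      show "\<zero>\<^bsub>V k\<^esub> \<oplus>\<^bsub>V k\<^esub> \<zero>\<^bsub>V k\<^esub> = \<zero>\<^bsub>V k\<^esub>" "c \<in> carrier R \<Longrightarrow> c \<odot>\<^bsub>V k\<^esub> \<zero>\<^bsub>V k\<^esub> = \<zero>\<^bsub>V k\<^esub>" by auto
    qed
    then have "\<forall>x\<in>S. \<forall>y\<in>S. \<forall>i\<in>I - A. (x \<oplus>\<^bsub>?D\<^esub> y) i = \<zero>\<^bsub>V i\<^esub>"
      "\<forall>c\<in>carrier R. \<forall>x\<in>S. \<forall>i\<in>I - A. (c \<odot>\<^bsub>?D\<^esub> x) i = \<zero>\<^bsub>V i\<^esub>"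
      "\<forall>i\<in>I - A. \<zero>\<^bsub>?D\<^esub> i = \<zero>\<^bsub>V i\<^esub>"
      by (auto simp: S_def direct_sum_def)
    then show ?thesis unfolding D.submodule_iff by (auto simp: S_def)
  qed
  \<comment> \<open>Independence of \<open>V a\<close> from \<open>S\<close>: the difference of
    \<open>s\<close> and the embedded \<open>v\<close> is supported in \<open>insert a A\<close> and
    has zero components on \<open>B\<close>, so it vanishes by the premise. Its component at
    \<open>a\<close> is the negative of \<open>v\<close>, because \<open>s\<close> is zero
    there.\<close>
  have ind: "v = \<zero>\<^bsub>V a\<^esub>"
    if v: "v \<in> carrier (V a)" and s: "s \<in> S" and eq: "\<forall>j\<in>B. f s j = f (?\<iota> v) j" for v s
  proof -
    let ?w = "?\<iota> ((\<ominus>\<^bsub>R\<^esub> \<one>\<^bsub>R\<^esub>) \<odot>\<^bsub>V a\<^esub> v)"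
    let ?x = "s \<oplus>\<^bsub>?D\<^esub> ?w"
    have mv: "(\<ominus>\<^bsub>R\<^esub> \<one>\<^bsub>R\<^esub>) \<odot>\<^bsub>V a\<^esub> v \<in> carrier (V a)" using v by auto
    have w: "?w \<in> carrier ?D" by (rule lmod_hom_closed[OF \<iota> mv])
    have sD: "s \<in> carrier ?D" using s by (simp add: S_def)
    have x: "?x \<in> carrier ?D" using w sD by simp
    have ev: "?x i = s i \<oplus>\<^bsub>V i\<^esub> ?w i" if "i \<in> I" for i using that by (simp add: direct_sum_def)
    have "?x i = \<zero>\<^bsub>V i\<^esub>" if i: "i \<in> I - insert a A" for i
    proof -
      interpret left_module R "V i" using Vl i by simp
      show ?thesis using ev[of i] i s by (simp add: S_def)
    qed
    moreover have "f ?x j = \<zero>\<^bsub>U j\<^esub>" if j: "j \<in> B" for j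
    proof -
      interpret Uj: left_module R "U j" using Ul j insert.prems by auto
      have "f (?\<iota> v) j \<in> carrier (U j)"
        using lmod_hom_closed[OF \<phi>[OF j] lmod_hom_closed[OF \<iota> v]] .
      moreover have "f ?x j = f s j \<oplus>\<^bsub>U j\<^esub> (\<ominus>\<^bsub>R\<^esub> \<one>\<^bsub>R\<^esub>) \<odot>\<^bsub>U j\<^esub> f (?\<iota> v) j"
        using lmod_hom_add[OF \<phi>[OF j] sD w]
          lmod_hom_smult[OF lmod_hom_comp[OF \<iota> \<phi>[OF j]], of "\<ominus>\<^bsub>R\<^esub> \<one>\<^bsub>R\<^esub>" v] v by auto
      ultimately show ?thesis using eq j by (simp add: Uj.smult_minus_one Uj.M.r_neg)
    qed
    ultimately have "?x = \<zero>\<^bsub>?D\<^esub>" using insert.prems(4)[OF x] by blast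
    then have "?x a = \<zero>\<^bsub>V a\<^esub>" using a by (simp add: direct_sum_def)
    moreover have "s a = \<zero>\<^bsub>V a\<^esub>" using s a by (simp add: S_def)
    ultimately have "\<ominus>\<^bsub>V a\<^esub> v = \<zero>\<^bsub>V a\<^esub>"
      using ev[OF a(1)] a v by (simp add: Va.smult_minus_one)
    then show ?thesis using v by (metis Va.M.add.inv_eq_1_iff)
  qed
  have "\<exists>j\<in>B. (\<forall>s\<in>S. (\<forall>k\<in>B - {j}. f s k = \<zero>\<^bsub>U k\<^esub>) \<longrightarrow> f s j = \<zero>\<^bsub>U j\<^esub>) \<and>
    inj_on (\<lambda>v. f (?\<iota> v) j) (carrier (V a))"
  proof (rule uniform_exchange[OF D S _ \<iota>, where U = U and \<phi> = "\<lambda>j x. f x j"])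
    show "uniform_module R (V a)" by (rule uniform_module_if_virtually_simple[OF V[OF a(1)]])
    show "finite B" by fact
    show "uniform_module R (U j)" if "j \<in> B" for j
      using uniform_module_if_virtually_simple U that insert.prems by blast
  qed (use \<phi> ind in auto)
  then obtain j where j: "j \<in> B" "inj_on (\<lambda>v. f (?\<iota> v) j) (carrier (V a))"
    and js: "\<And>s. \<lbrakk>s \<in> S; \<forall>k\<in>B - {j}. f s k = \<zero>\<^bsub>U k\<^esub>\<rbrakk> \<Longrightarrow> f s j = \<zero>\<^bsub>U j\<^esub>" by blast
  have jJ: "j \<in> J" using j insert.prems by auto
  \<comment> \<open>After dropping \<open>j\<close> the premise persists: by \<open>js\<close>, a
    family in \<open>S\<close> with zero components on \<open>B - {j}\<close> has zero component at
    \<open>j\<close> as well.\<close>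
  have "\<exists>\<tau>. inj_on \<tau> A \<and> \<tau> ` A \<subseteq> B - {j} \<and> (\<forall>i\<in>A. lmod_isomorphic R (V i) (U (\<tau> i)))"
  proof (rule insert.IH)
    fix x assume x: "x \<in> carrier ?D" "\<forall>i\<in>I - A. x i = \<zero>\<^bsub>V i\<^esub>" "\<forall>k\<in>B - {j}. f x k = \<zero>\<^bsub>U k\<^esub>"
    then have "\<forall>k\<in>B. f x k = \<zero>\<^bsub>U k\<^esub>" using js[of x] by (auto simp: S_def)
    then show "x = \<zero>\<^bsub>?D\<^esub>" using insert.prems(4)[OF x(1)] x(2) by blast
  qed (use insert.prems in auto)
  then obtain \<tau> where \<tau>: "inj_on \<tau> A" "\<tau> ` A \<subseteq> B - {j}"
    "\<forall>i\<in>A. lmod_isomorphic R (V i) (U (\<tau> i))" by blast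
  let ?h = "\<lambda>v. f (?\<iota> v) j"
  let ?H = "?h ` carrier (V a)"
  have h: "?h \<in> lmod_hom R (V a) (U j)" using lmod_hom_comp[OF \<iota> \<phi>[OF j(1)]] .
  have H: "submodule ?H R (U j)"
    by (rule lmod_hom_submodule_image[OF Vl[OF a(1)] Ul[OF jJ] h Va.submodule_carrier])
  obtain v where v: "v \<in> carrier (V a)" "v \<noteq> \<zero>\<^bsub>V a\<^esub>"
    using V[OF a(1)] Va.M.zero_closed by (fastforce simp: virtually_simple_def)
  then have "?h v \<noteq> \<zero>\<^bsub>U j\<^esub>"
    using lmod_hom_inj_on_iff[OF Vl[OF a(1)] Ul[OF jJ] h] j(2) v by auto
  then have "?H \<noteq> {\<zero>\<^bsub>U j\<^esub>}" using v(1) by auto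
  \<comment> \<open>The image of \<open>V a\<close> is a nonzero submodule of the virtually simple
    \<open>U j\<close>, which upgrades the embedding to an isomorphism between \<open>V a\<close>
    and \<open>U j\<close>.\<close>
  then have "lmod_isomorphic R (U j\<lparr>carrier := ?H\<rparr>) (U j)"
    using U[OF jJ] H by (simp add: virtually_simple_def)
  moreover have "lmod_isomorphic R (V a) (U j\<lparr>carrier := ?H\<rparr>)"
    unfolding lmod_isomorphic_def
  proof (rule bexI)
    show "bij_betw ?h (carrier (V a)) (carrier (U j\<lparr>carrier := ?H\<rparr>))"
      using j(2) by (simp add: bij_betw_def)
    show "?h \<in> lmod_hom R (V a) (U j\<lparr>carrier := ?H\<rparr>)"
      by (rule lmod_homI) (use lmod_homD[OF h] in auto)
  qed
  ultimately have "lmod_isomorphic R (V a) (U j)" by (rule lmod_isomorphic_trans[rotated])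
  \<comment> \<open>Injectivity survives the update since \<tau> sends \<open>A\<close> into
    \<open>B - {j}\<close>.\<close>
  then have "inj_on (\<tau>(a := j)) (insert a A) \<and> \<tau>(a := j) ` insert a A \<subseteq> B \<and>
    (\<forall>i\<in>insert a A. lmod_isomorphic R (V i) (U ((\<tau>(a := j)) i)))"
    using \<tau> a j(1) by (auto simp: inj_on_def)
  then show ?case by blast
qed

text \<open>The exchange starts from the full index sets, where its independence premise is just
  injectivity of \<open>f\<close>.\<close>

lemma direct_sum_embedding_matching:
  assumes R: "ring R" and fin: "finite I" "finite J"
    and V: "\<And>i. i \<in> I \<Longrightarrow> virtually_simple R (V i)"
    and U: "\<And>j. j \<in> J \<Longrightarrow> virtually_simple R (U j)"
    and f: "f \<in> lmod_hom R (direct_sum I V) (direct_sum J U)"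
    and inj: "inj_on f (carrier (direct_sum I V))"
  shows "\<exists>\<tau>. inj_on \<tau> I \<and> \<tau> ` I \<subseteq> J \<and> (\<forall>i\<in>I. lmod_isomorphic R (V i) (U (\<tau> i)))"
proof (rule direct_sum_matching[OF R V U f])
  have D: "left_module R (direct_sum I V)" "left_module R (direct_sum J U)"
    using V U by (auto intro!: left_module_direct_sum[OF R] simp: virtually_simple_def)
  fix x assume x: "x \<in> carrier (direct_sum I V)" "\<forall>j\<in>J. f x j = \<zero>\<^bsub>U j\<^esub>"
  have "f x \<in> carrier (direct_sum J U)" using lmod_hom_closed[OF f x(1)] .
  then have "f x = \<zero>\<^bsub>direct_sum J U\<^esub>"
    \<comment> \<open>Families are fixed outside \<open>J\<close>, so vanishing on \<open>J\<close>
      determines \<open>f x\<close> completely.\<close>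
    using x(2) by (auto simp: direct_sum_def fun_eq_iff PiE_iff extensional_def)
  then show "x = \<zero>\<^bsub>direct_sum I V\<^esub>" using lmod_hom_inj_on_iff[OF D f] inj x(1) by blast
qed (use fin in auto)

theorem theorem2p17:
  fixes R :: "('r, 'c) ring_scheme"
    and V :: "nat \<Rightarrow> ('r, 'a, 'd) module_scheme"
    and U :: "nat \<Rightarrow> ('r, 'b, 'e) module_scheme"
    and M :: "('r, nat \<Rightarrow> 'a) module"
    and N :: "('r, nat \<Rightarrow> 'b) module"
    and n m :: nat
  assumes "ring R"
    and "M = direct_sum {1..n} V"
    and "N = direct_sum {1..m} U"
    and "\<And>i. i \<in> {1..n} \<Longrightarrow> virtually_simple R (V i)"
    and "\<And>j. j \<in> {1..m} \<Longrightarrow> virtually_simple R (U j)"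
    and "subisomorphic R M N"
  shows "n = m \<and>
    (\<exists>\<sigma>. \<sigma> permutes {1..n} \<and> (\<forall>i\<in>{1..n}. lmod_isomorphic R (U i) (V (\<sigma> i))))"
proof -
  obtain f where f: "f \<in> lmod_hom R M N" "inj_on f (carrier M)"
    using assms(6) by (auto simp: subisomorphic_def)
  obtain g where g: "g \<in> lmod_hom R N M" "inj_on g (carrier N)"
    using assms(6) by (auto simp: subisomorphic_def)
  \<comment> \<open>\<rho> supplies n \<le> m. The permutation comes from \<tau>, obtained from the
    embedding of \<open>N\<close> into \<open>M\<close>, since this matches each \<open>U j\<close>
    with a summand of \<open>M\<close>, as the conclusion asks.\<close>
  obtain \<rho> where \<rho>: "inj_on \<rho> {1..n}" "\<rho> ` {1..n} \<subseteq> {1..m}"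
    using direct_sum_embedding_matching[OF assms(1) finite_atLeastAtMost finite_atLeastAtMost
        assms(4,5) f[unfolded assms(2,3)]] by blast
  obtain \<tau> where \<tau>: "inj_on \<tau> {1..m}" "\<tau> ` {1..m} \<subseteq> {1..n}"
    "\<forall>j\<in>{1..m}. lmod_isomorphic R (U j) (V (\<tau> j))"
    using direct_sum_embedding_matching[OF assms(1) finite_atLeastAtMost finite_atLeastAtMost
        assms(5,4) g[unfolded assms(2,3)]] by blast
  have nm: "n = m"
    using card_inj_on_le[OF \<rho>] card_inj_on_le[OF \<tau>(1,2)] by simp
  \<comment> \<open>Nothing is known of \<tau> outside the index set, whereas a permutation of it
    must fix all other numbers.\<close>
  let ?\<sigma> = "\<lambda>i. if i \<in> {1..n} then \<tau> i else i"
  \<comment> \<open>An injective self-map of a finite set is onto.\<close>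
  have "\<tau> ` {1..n} = {1..n}" using \<tau> nm by (intro endo_inj_surj) auto
  then have "bij_betw \<tau> {1..n} {1..n}" using \<tau>(1) nm by (simp add: bij_betw_def)
  then have "bij_betw ?\<sigma> {1..n} {1..n}" by (rule bij_betw_cong[THEN iffD1, rotated]) simp
  then have "?\<sigma> permutes {1..n}" by (rule bij_imp_permutes) auto
  then show ?thesis using \<tau>(3) nm by (intro conjI exI[of _ ?\<sigma>]) auto
qed

end
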